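(* For $\mathrm{Re}(x)>0$, we have (1) $$\mathcal{J}_1(x)=3\mathcal{F}_1(x)-2\mathcal{F}_1(2x)-\mathcal{F}_1\!\left(\frac x2\right)+\frac{1+x}{2x}\log(2);$$ (2) $$\mathcal{J}_1(x)-\frac1x\,\mathcal{J}_1\!\left(\frac1x\right)=0.$$
   Context: For $x\in\mathbb{C}\setminus(-\infty,0]$, let $$\mathcal{F}_1(x)=\sum_{n=1}^\infty\left\{\psi(nx)+\frac{1}{2nx}-\log(nx)\right\}-\frac12\left(\gamma-\log\left(\frac{2\pi}{x}\right)\right),$$ where $\psi=\Gamma'/\Gamma$ is the digamma function, $\gamma$ is Euler's constant, and $\log$ is the principal branch. For $\mathrm{Re}(x)>0$, let $$J_1(x)=\int_0^\infty\frac{dt}{(1+e^{-t})(1+e^{xt})},\qquad\mathcal{J}_1(x)=J_1(x)+\log(2).$$ *)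

theory Defs
  imports "HOL-Analysis.Analysis"
begin

(* Meaningful for x outside (-infinity, 0], where the terms are O(1/n^2)
   and the series converges absolutely. The summation index n >= 1 is written as Suc k;
   ln on complex numbers is the principal branch. *)
definition calF1 :: "complex \<Rightarrow> complex" where
  "calF1 x = (\<Sum>k. Digamma (of_nat (Suc k) * x) + 1 / (2 * of_nat (Suc k) * x)
                    - ln (of_nat (Suc k) * x))
             - 1 / 2 * (euler_mascheroni - ln (2 * of_real pi / x))"

(* Meaningful for Re x > 0, where the integrand is bounded by exp (- Re x * t) / (1 - exp (- Re x * t))
   for large t and is continuous on [0, infinity), hence Lebesgue integrable. *)
definition J1 :: "complex \<Rightarrow> complex" where
  "J1 x = set_lebesgue_integral lborel {0<..}
            (\<lambda>t::real. 1 / ((1 + exp (- of_real t)) * (1 + exp (x * of_real t))))"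

definition calJ1 :: "complex \<Rightarrow> complex" where
  "calJ1 x = J1 x + of_real (ln 2)"

end

theory Submission
  imports Defs "HOL-Complex_Analysis.Complex_Analysis" "HOL-Real_Asymp.Real_Asymp"
begin

text \<open>
  Let $R(w) = \psi(w) + 1/(2w) - \ln w$, so that $\mathcal{F}_1(x)$ is the sum of $R(nx)$ over
  $n \geq 1$ up to elementary terms. The combination in (1) involves $R$ only through the
  differences $R(2z) - R(z)$, because
  \[ 3R(w) - 2R(2w) - R(w/2) = (R(w) - R(w/2)) - 2\,(R(2w) - R(w)). \]
  In such a difference the logarithm disappears, and comparing Gauss's limits for $\psi(w)$ and
  $\psi(w/2)$ gives the nonsingular Laplace transform
  \[ R(w) - R(w/2) = D(w) = \int_0^\infty e^{-wt} c(t)\,dt,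
     \qquad c(t) = \frac{1}{1+e^{-t}} - \frac12 \]
  (lemma \<open>digamma_rem_double\<close>). Now sum $D(nx) - 2D(2nx)$ over $n$. Under the integral sign the
  geometric series $\sum_n (y^n - 2y^{2n}) = y/(1+y)$ with $y = e^{-xt}$ produces the factor
  $1/(1+e^{xt})$, and the exchange is justified by $0 \leq c(t) \leq t/2$. Hence the sum is
  $J_1(x) - \frac12 \int_0^\infty dt/(1+e^{xt}) = J_1(x) - \ln 2/(2x)$ (lemma \<open>J1_sums\<close>).
  To split this sum into the three series of (1), each must converge on its own; this follows from
  $R(w) = O((\mathrm{Re}\,w)^{-2})$ (lemma \<open>digamma_rem_bound\<close>), where $R(w) - R(w+1)$ is an
  error of the trapezoidal rule for the logarithm.

  For real $x$, (2) is the substitution $t = xu$ together with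
  $1/(1+e^{s}) = 1 - 1/(1+e^{-s})$. Both sides are holomorphic in the right half-plane, since the
  series $\sum_n (D(nx) - 2D(2nx))$ converges locally uniformly and $D$ is a combination of digamma
  functions, so the identity theorem extends (2) to complex $x$.
\<close>

section \<open>The remainder of the digamma function\<close>

text \<open>
  The summand of the series in \<^const>\<open>calF1\<close>, as a function of its argument. It is what
  remains of the digamma function after the first two terms of its asymptotic expansion.
\<close>
definition digamma_rem :: "complex \<Rightarrow> complex" where
  "digamma_rem w = Digamma w + 1 / (2 * w) - ln w"

text \<open>
  This is the error of the trapezoidal rule for the integral of $1/s$ over $[w, w+1]$ with
  $w = 1/u$. The derivative of the left-hand side in $u$ is exactly $-u^2/(2(1+u)^2)$, where
  $|1+u| \geq 1$, so the cubic bound follows by integrating along the segment from $0$ to $u$.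
\<close>
lemma trapezoid_error_Ln:
  fixes u :: complex
  assumes "Re u \<ge> 0"
  shows "norm (ln (1 + u) - u / 2 - u / (2 * (1 + u))) \<le> norm u ^ 3 / 2"
proof -
  define E where "E = (\<lambda>v::complex. ln (1 + v) - v / 2 - v / (2 * (1 + v)))"
  have Re: "Re v \<ge> 0" "norm v \<le> norm u" if v: "v \<in> closed_segment 0 u" for v
    using v assms by (auto simp: closed_segment_def norm_mult mult_left_le_one_le)
  have "norm (E u - E 0) \<le> norm u ^ 2 / 2 * norm (u - 0)"
  proof (rule field_differentiable_bound[where S = "closed_segment 0 u"
        and f' = "\<lambda>v. - (v ^ 2 / (2 * (1 + v) ^ 2))"])
    fix v assume v: "v \<in> closed_segment 0 u"
    have "1 + v \<noteq> 0" "1 + v \<notin> \<real>\<^sub>\<le>\<^sub>0" using Re[OF v]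
      by (auto simp: complex_eq_iff complex_nonpos_Reals_iff)
    then show "(E has_field_derivative - (v ^ 2 / (2 * (1 + v) ^ 2))) (at v within closed_segment 0 u)"
    proof -
      have "(E has_field_derivative
          1 / (1 + v) - 1 / 2 - (2 * (1 + v) - v * 2) / (2 * (1 + v)) ^ 2) (at v within closed_segment 0 u)"
        unfolding E_def using \<open>1 + v \<noteq> 0\<close> \<open>1 + v \<notin> \<real>\<^sub>\<le>\<^sub>0\<close> mult_eq_0_iff[of 2 "1 + v"]
        by (auto intro!: derivative_eq_intros simp: power2_eq_square inverse_eq_divide)
      moreover have "1 / y - 1 / 2 - (2 * y - (y - 1) * 2) / (2 * y) ^ 2 = - ((y - 1) ^ 2 / (2 * y ^ 2))"
        if "y \<noteq> 0" for y :: complex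
        using that by (simp add: divide_simps) (simp add: power2_eq_square algebra_simps)
      from this[of "1 + v"] have "1 / (1 + v) - 1 / 2 - (2 * (1 + v) - v * 2) / (2 * (1 + v)) ^ 2
          = - (v ^ 2 / (2 * (1 + v) ^ 2))"
        using \<open>1 + v \<noteq> 0\<close> by simp
      ultimately show ?thesis by simp
    qed
    have "1 \<le> Re (1 + v)" using Re[OF v] by simp
    also have "\<dots> \<le> norm (1 + v)" by (rule complex_Re_le_cmod)
    finally have "1 \<le> norm (1 + v) ^ 2" by simp
    then have "norm v ^ 2 \<le> norm u ^ 2 * norm (1 + v) ^ 2"
      using mult_mono[of "norm v ^ 2" "norm u ^ 2" 1 "norm (1 + v) ^ 2"] Re(2)[OF v] by (simp add: power_mono)
    then show "norm (- (v ^ 2 / (2 * (1 + v) ^ 2))) \<le> norm u ^ 2 / 2"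
      using \<open>1 + v \<noteq> 0\<close> by (simp add: norm_divide norm_mult norm_power divide_simps mult_ac)
  qed auto
  then show ?thesis by (simp add: E_def power3_eq_cube power2_eq_square)
qed

lemma ln_mult_Re_pos:
  fixes w z :: complex
  assumes "Re w > 0" "Re z > 0"
  shows "ln (w * z) = ln w + ln z"
proof -
  have "w \<noteq> 0" "z \<noteq> 0" using assms by auto
  then show ?thesis
    using Re_Ln_pos_lt_imp[of w] Re_Ln_pos_lt_imp[of z] assms by (intro Ln_times_simple) auto
qed

lemma Re_inverse_pos:
  assumes "Re w > 0"
  shows "Re (1 / w) > 0"
proof -
  have "Im w ^ 2 + Re w ^ 2 > 0" using assms by (simp add: add_nonneg_pos)
  then show ?thesis using assms by (simp add: Re_divide add.commute)
qed

text \<open>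
  By the functional equation of the digamma function, consecutive remainders differ by the
  trapezoidal error with $u = 1/w$.
\<close>
lemma digamma_rem_step:
  assumes "Re w > 0"
  shows "norm (digamma_rem w - digamma_rem (w + 1)) \<le> 1 / (2 * norm w ^ 3)"
proof -
  have w: "w \<noteq> 0" "w + 1 \<noteq> 0" using assms by (auto simp: complex_eq_iff)
  have "ln (w + 1) = ln (w * (1 + 1 / w))" using w by (simp add: distrib_left)
  also have "\<dots> = ln w + ln (1 + 1 / w)"
    using assms Re_inverse_pos[OF assms] by (intro ln_mult_Re_pos) auto
  finally have "digamma_rem w - digamma_rem (w + 1) =
      ln (1 + 1 / w) - (1 / w) / 2 - (1 / w) / (2 * (1 + 1 / w))"
    using w Digamma_plus1[OF w(1)] by (simp add: digamma_rem_def) (simp add: divide_simps)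
  also have "norm \<dots> \<le> norm (1 / w) ^ 3 / 2"
    using Re_inverse_pos[OF assms] by (intro trapezoid_error_Ln) auto
  finally show ?thesis by (simp add: norm_divide power_divide)
qed

text \<open>
  Shifting by $N$ adds the partial sum of $1/(w+n)$ to the digamma function, so Gauss's limit
  says precisely that $\psi(w+N) - \ln N \to 0$; and $\ln(w+N) - \ln N = \ln(1 + w/N) \to 0$.
\<close>
lemma digamma_rem_tendsto_0:
  assumes "Re w > 0"
  shows "(\<lambda>N. digamma_rem (w + of_nat N)) \<longlonglongrightarrow> 0"
proof -
  have w: "w + of_nat n \<noteq> 0" for n using assms by (auto simp: complex_eq_iff)
  have psi: "Digamma (w + of_nat N) = Digamma w + (\<Sum>n<N. inverse (w + of_nat n))" for N
  proof (induction N)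
    case (Suc N)
    then show ?case using Digamma_plus1[OF w[of N]] by (simp add: add_ac inverse_eq_divide)
  qed auto
  have "(\<lambda>N. Digamma w - (of_real (ln (real N)) - (\<Sum>n<N. inverse (w + of_nat n))))
          \<longlonglongrightarrow> Digamma w - Digamma w"
    using Digamma_LIMSEQ[of w] w[of 0] by (intro tendsto_intros) auto
  then have 1: "(\<lambda>N. Digamma (w + of_nat N) - of_real (ln (real N))) \<longlonglongrightarrow> 0"
    by (simp add: psi algebra_simps)
  have inv: "(\<lambda>N. 1 / of_nat N :: complex) \<longlonglongrightarrow> 0"
    by (rule lim_const_over_n)
  have "(\<lambda>N. ln (1 + w * (1 / of_nat N))) \<longlonglongrightarrow> ln (1 + w * 0)"
    by (intro tendsto_intros inv) (auto simp: complex_nonpos_Reals_iff)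
  moreover have "\<forall>\<^sub>F N in sequentially. ln (1 + w * (1 / of_nat N)) = ln (w + of_nat N) - of_real (ln (real N))"
    using eventually_gt_at_top[of 0]
  proof eventually_elim
    case (elim N)
    have "w + of_nat N = of_nat N * (1 + w * (1 / of_nat N))" using elim by (simp add: field_simps)
    also have "ln \<dots> = ln (of_nat N) + ln (1 + w * (1 / of_nat N))"
      using elim assms by (intro ln_mult_Re_pos) (auto simp: Re_divide_of_nat add_pos_nonneg)
    also have "ln (of_nat N :: complex) = of_real (ln (real N))"
      using elim by (metis Ln_of_real of_nat_0_less_iff of_real_of_nat_eq)
    finally show ?case by simp
  qed
  ultimately have 2: "(\<lambda>N. ln (w + of_nat N) - of_real (ln (real N))) \<longlonglongrightarrow> 0"
    by (simp cong: filterlim_cong)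
  have "filterlim (\<lambda>N. w + of_nat N) at_infinity sequentially"
    by (rule tendsto_add_filterlim_at_infinity[OF tendsto_const tendsto_of_nat])
  then have 3: "(\<lambda>N. 1 / (w + of_nat N)) \<longlonglongrightarrow> 0"
    by (intro tendsto_divide_0[OF tendsto_const])
  have "(\<lambda>N. (Digamma (w + of_nat N) - of_real (ln (real N))) + (1 / 2) * (1 / (w + of_nat N))
         - (ln (w + of_nat N) - of_real (ln (real N)))) \<longlonglongrightarrow> 0 + (1 / 2) * 0 - 0"
    by (intro tendsto_intros 1 2 3)
  then show ?thesis by (simp add: digamma_rem_def add_diff_eq)
qed

text \<open>
  The remainder is the sum of its consecutive differences, which are $O(|w+n|^{-3})$. They are
  compared with the telescoping differences of $K/y^2$ for $y = \mathrm{Re}\,(w+n)$; the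
  constant $K$ is what makes this comparison valid for all $y \geq a$.
\<close>
lemma digamma_rem_bound:
  assumes "a > 0" "Re w \<ge> a"
  shows "norm (digamma_rem w) \<le> (1 + 1 / a) ^ 2 / 2 / Re w ^ 2"
proof -
  define K where "K = (1 + 1 / a) ^ 2 / 2"
  have step: "norm (digamma_rem v - digamma_rem (v + 1)) \<le> K / Re v ^ 2 - K / (Re v + 1) ^ 2"
    if v: "Re v \<ge> a" for v
  proof -
    define y where "y = Re v"
    have y: "y > 0" "y \<ge> a" using v assms by (auto simp: y_def)
    \<comment> \<open>The telescoping difference is K(2y+1) / (y^2 (y+1)^2), so domination of 1 / (2 y^3)
      amounts to (y+1)^2 <= 2 K y (2y+1).\<close>
    have "y + 1 \<le> y * (1 + 1 / a)" using y assms by (simp add: field_simps)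
    then have "(y + 1) ^ 2 \<le> (y * (1 + 1 / a)) ^ 2" using y by (intro power_mono) auto
    also have "\<dots> = 2 * K * y * y" by (simp add: K_def power2_eq_square)
    also have "\<dots> \<le> 2 * K * y * (2 * y + 1)" using y by (intro mult_left_mono) (auto simp: K_def)
    finally have *: "(y + 1) ^ 2 \<le> 2 * K * y * (2 * y + 1)" .
    have "norm (digamma_rem v - digamma_rem (v + 1)) \<le> 1 / (2 * norm v ^ 3)"
      using y by (intro digamma_rem_step) (auto simp: y_def)
    also have "\<dots> \<le> 1 / (2 * y ^ 3)"
      using y complex_Re_le_cmod[of v] by (intro divide_left_mono mult_left_mono power_mono mult_pos_pos zero_less_power) (auto simp: y_def)
    also have "\<dots> = (y + 1) ^ 2 / (2 * y ^ 3 * (y + 1) ^ 2)" using y by simp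
    also have "\<dots> \<le> (2 * K * y * (2 * y + 1)) / (2 * y ^ 3 * (y + 1) ^ 2)"
      using * y by (intro divide_right_mono) auto
    also have "\<dots> = K / y ^ 2 - K / (y + 1) ^ 2"
    proof -
      have "y \<noteq> 0" "y + 1 \<noteq> 0" using y by auto
      then show ?thesis by (simp add: divide_simps) (simp add: power2_eq_square power3_eq_cube algebra_simps)
    qed
    finally show ?thesis by (simp add: y_def)
  qed
  have tele: "norm (digamma_rem w - digamma_rem (w + of_nat N)) \<le> K / Re w ^ 2 - K / (Re w + real N) ^ 2" for N
  proof (induction N)
    case (Suc N)
    have "norm (digamma_rem (w + of_nat N) - digamma_rem (w + of_nat N + 1))
        \<le> K / (Re w + real N) ^ 2 - K / (Re w + real N + 1) ^ 2"
      using step[of "w + of_nat N"] assms by simp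
    with Suc show ?case
      using norm_triangle_ineq[of "digamma_rem w - digamma_rem (w + of_nat N)"
          "digamma_rem (w + of_nat N) - digamma_rem (w + of_nat N + 1)"]
      by (simp add: add_ac)
  qed auto
  have "(\<lambda>N. norm (digamma_rem w - digamma_rem (w + of_nat N))) \<longlonglongrightarrow> norm (digamma_rem w - 0)"
    using assms by (intro tendsto_intros digamma_rem_tendsto_0) auto
  moreover have "norm (digamma_rem w - digamma_rem (w + of_nat N)) \<le> K / Re w ^ 2" for N
  proof -
    have "K / (Re w + real N) ^ 2 \<ge> 0" by (simp add: K_def)
    with tele[of N] show ?thesis by linarith
  qed
  ultimately have "norm (digamma_rem w - 0) \<le> K / Re w ^ 2"
    by (intro LIMSEQ_le_const2) auto
  then show ?thesis by (simp add: K_def)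
qed

lemma summable_inverse_Suc_squared: "summable (\<lambda>k. C / (real (Suc k) * a) ^ 2)"
proof -
  have "summable (\<lambda>k. inverse (real (Suc k) ^ 2))"
    using inverse_power_summable[of 2, where 'a=real] by (subst summable_Suc_iff) simp
  then have "summable (\<lambda>k. C / a ^ 2 * inverse (real (Suc k) ^ 2))" by (rule summable_mult)
  moreover have "C / a ^ 2 * inverse (real (Suc k) ^ 2) = C / (real (Suc k) * a) ^ 2" for k
    by (simp only: power_mult_distrib) (simp add: field_simps)
  ultimately show ?thesis by (simp only:)
qed

lemma summable_digamma_rem:
  assumes "Re x > 0"
  shows "summable (\<lambda>k. digamma_rem (of_nat (Suc k) * x))"
proof (rule summable_comparison_test)
  show "summable (\<lambda>k. (1 + 1 / Re x) ^ 2 / 2 / (real (Suc k) * Re x) ^ 2)"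
    by (rule summable_inverse_Suc_squared)
  show "\<exists>N. \<forall>n\<ge>N. norm (digamma_rem (of_nat (Suc n) * x)) \<le> (1 + 1 / Re x) ^ 2 / 2 / (real (Suc n) * Re x) ^ 2"
  proof (intro exI allI impI)
    fix n :: nat
    have "Re (of_nat (Suc n) * x) = real (Suc n) * Re x" by simp
    moreover have "Re x \<le> real (Suc n) * Re x" using assms by simp
    ultimately show "norm (digamma_rem (of_nat (Suc n) * x)) \<le> (1 + 1 / Re x) ^ 2 / 2 / (real (Suc n) * Re x) ^ 2"
      using digamma_rem_bound[of "Re x" "of_nat (Suc n) * x"] assms by simp
  qed
qed

section \<open>Elementary integrals over the half-line\<close>

lemma set_integral_FTC_greaterThan:
  fixes f F :: "real \<Rightarrow> 'a::euclidean_space"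
  assumes "\<And>t. t > a \<Longrightarrow> (F has_vector_derivative f t) (at t)"
    and "\<And>t. t > a \<Longrightarrow> isCont f t"
    and "set_integrable lborel {a<..} f"
    and "(F \<longlongrightarrow> A) (at_right a)" "(F \<longlongrightarrow> B) at_top"
  shows "set_lebesgue_integral lborel {a<..} f = B - A"
proof -
  have "(LBINT t=ereal a..\<infinity>. f t) = B - A"
    using assms by (intro interval_integral_FTC_integrable[where F = F])
      (auto simp: ereal_tendsto_simps)
  then show ?thesis by (simp add: interval_integral_to_infinity_eq)
qed

lemma set_integral_FTC_greaterThan_nonneg:
  fixes f F :: "real \<Rightarrow> real"
  assumes "\<And>t. t > a \<Longrightarrow> (F has_field_derivative f t) (at t)"
    and "\<And>t. t > a \<Longrightarrow> isCont f t"
    and "\<And>t. t > a \<Longrightarrow> f t \<ge> 0"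
    and "(F \<longlongrightarrow> A) (at_right a)" "(F \<longlongrightarrow> B) at_top"
  shows "set_integrable lborel {a<..} f" "set_lebesgue_integral lborel {a<..} f = B - A"
proof -
  have "set_integrable lborel (einterval (ereal a) \<infinity>) f \<and> (LBINT t=ereal a..\<infinity>. f t) = B - A"
    using assms by (intro conjI interval_integral_FTC_nonneg[where F = F])
      (auto simp: ereal_tendsto_simps)
  then show "set_integrable lborel {a<..} f" "set_lebesgue_integral lborel {a<..} f = B - A"
    by (simp_all add: interval_integral_to_infinity_eq)
qed

lemma exp_real_greaterThan_0:
  fixes a :: real
  assumes "a > 0"
  shows "set_integrable lborel {0<..} (\<lambda>t. exp (- (a * t)))"
    and "set_lebesgue_integral lborel {0<..} (\<lambda>t. exp (- (a * t))) = 1 / a"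
proof -
  have 0: "((\<lambda>t. - exp (- (a * t)) / a) \<longlongrightarrow> - exp (- (a * 0)) / a) (at_right 0)"
    using assms by (intro tendsto_intros) auto
  have 1: "((\<lambda>t. - exp (- (a * t)) / a) \<longlongrightarrow> 0) at_top"
    using assms by real_asymp
  have 2: "((\<lambda>t. - exp (- (a * t)) / a) has_field_derivative exp (- (a * t))) (at t)" for t
    using assms by (auto intro!: derivative_eq_intros)
  show "set_integrable lborel {0<..} (\<lambda>t. exp (- (a * t)))"
    "set_lebesgue_integral lborel {0<..} (\<lambda>t. exp (- (a * t))) = 1 / a"
    using set_integral_FTC_greaterThan_nonneg[OF 2 _ _ 0 1] by auto
qed

lemma mult_exp_real_greaterThan_0:
  fixes a :: real
  assumes "a > 0"
  shows "set_integrable lborel {0<..} (\<lambda>t. t * exp (- (a * t)))"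
    and "set_lebesgue_integral lborel {0<..} (\<lambda>t. t * exp (- (a * t))) = 1 / a ^ 2"
proof -
  define F where "F = (\<lambda>t::real. - (t / a + 1 / a ^ 2) * exp (- (a * t)))"
  have 0: "(F \<longlongrightarrow> F 0) (at_right 0)"
    unfolding F_def using assms by (intro tendsto_intros) auto
  have 1: "(F \<longlongrightarrow> 0) at_top"
    unfolding F_def using assms by real_asymp
  have 2: "(F has_field_derivative t * exp (- (a * t))) (at t)" for t
    unfolding F_def using assms by (auto intro!: derivative_eq_intros simp: field_simps power2_eq_square)
  show "set_integrable lborel {0<..} (\<lambda>t. t * exp (- (a * t)))"
    "set_lebesgue_integral lborel {0<..} (\<lambda>t. t * exp (- (a * t))) = 1 / a ^ 2"
    using set_integral_FTC_greaterThan_nonneg[OF 2 _ _ 0 1] by (auto simp: F_def)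
qed

lemma set_integrable_exp_dominated:
  fixes f :: "real \<Rightarrow> complex"
  assumes "continuous_on {0<..} f" "a > 0"
    and "\<And>t. t > 0 \<Longrightarrow> norm (f t) \<le> C * exp (- (a * t))"
  shows "set_integrable lborel {0<..} f"
proof (rule set_integrable_bound)
  show "set_integrable lborel {0<..} (\<lambda>t. C * exp (- (a * t)))"
    using exp_real_greaterThan_0[OF assms(2)] by (intro set_integrable_mult_right)
  show "set_borel_measurable lborel {0<..} f"
    using borel_measurable_continuous_on_indicator[OF _ assms(1)]
    by (simp add: set_borel_measurable_def)
  show "AE t in lborel. t \<in> {0<..} \<longrightarrow> norm (f t) \<le> norm (C * exp (- (a * t)))"
    using assms(3) by (auto intro: order_trans[OF _ abs_ge_self])
qed

lemma exp_complex_greaterThan_0: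
  fixes z :: complex
  assumes "Re z > 0"
  shows "set_integrable lborel {0<..} (\<lambda>t. exp (- (z * of_real t)))"
    and "set_lebesgue_integral lborel {0<..} (\<lambda>t. exp (- (z * of_real t))) = 1 / z"
proof -
  show int: "set_integrable lborel {0<..} (\<lambda>t. exp (- (z * of_real t)))"
    by (rule set_integrable_exp_dominated[where a = "Re z" and C = 1])
       (use assms in \<open>auto intro!: continuous_intros\<close>)
  define F where "F = (\<lambda>t. - exp (- (z * of_real t)) / z)"
  have z: "z \<noteq> 0" using assms by auto
  have "((\<lambda>t. exp (- (Re z * t)) / norm z) \<longlongrightarrow> 0) at_top"
    using assms z by real_asymp
  then have 1: "(F \<longlongrightarrow> 0) at_top"
    by (subst tendsto_norm_zero_iff [symmetric]) (simp add: F_def norm_divide)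
  have 0: "(F \<longlongrightarrow> F 0) (at_right 0)"
    unfolding F_def using z by (auto intro!: tendsto_eq_intros)
  have 2: "(F has_vector_derivative exp (- (z * of_real t))) (at t)" for t
    unfolding F_def using z
    by (auto intro!: has_vector_derivative_real_field derivative_eq_intros)
  show "set_lebesgue_integral lborel {0<..} (\<lambda>t. exp (- (z * of_real t))) = 1 / z"
    using set_integral_FTC_greaterThan[OF 2 _ int 0 1] by (simp add: F_def)
qed

text \<open>
  For complex $x$ the number $e^{-xt}$ can come near $-1$ only if its argument has turned by
  about $\pi$, and by then its modulus has dropped. Quantitatively: for $|x|t \leq 1$ the real part
  of $e^{-xt}$ is nonnegative, and for $|x|t > 1$ its modulus is below
  $e^{-\mathrm{Re}\,x/|x|}$. This uniform gap makes the integrals with denominator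
  $1 + e^{xt}$ converge.
\<close>
lemma norm_one_plus_exp_neg_ge:
  fixes x :: complex
  assumes "Re x > 0"
  obtains \<delta> where "\<delta> > 0" "\<And>t. t \<ge> 0 \<Longrightarrow> \<delta> \<le> norm (1 + exp (- (x * of_real t)))"
proof
  show "1 - exp (- Re x / norm x) > 0" using assms by (auto simp: divide_pos_pos complex_eq_iff)
  fix t :: real assume t: "t \<ge> 0"
  show "1 - exp (- Re x / norm x) \<le> norm (1 + exp (- (x * of_real t)))"
  proof (cases "norm x * t \<le> 1")
    case True
    have "\<bar>Im x * t\<bar> \<le> norm x * t"
      using abs_Im_le_cmod[of x] t by (simp add: abs_mult mult_right_mono)
    then have "\<bar>Im x * t\<bar> \<le> pi / 2" using True pi_ge_two by linarith
    then have "cos (Im x * t) \<ge> 0" by (intro cos_ge_zero) auto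
    then have "1 \<le> Re (1 + exp (- (x * of_real t)))" by (simp add: Re_exp)
    also have "\<dots> \<le> norm (1 + exp (- (x * of_real t)))" by (rule complex_Re_le_cmod)
    finally show ?thesis using exp_gt_zero[of "- Re x / norm x"] by linarith
  next
    case False
    then have "1 / norm x \<le> t" using assms by (auto simp: divide_le_eq mult.commute complex_eq_iff not_le)
    then have "Re x * (1 / norm x) \<le> Re x * t" using assms by (intro mult_left_mono) auto
    then have "exp (- (Re x * t)) \<le> exp (- Re x / norm x)" by simp
    moreover have "norm (exp (- (x * of_real t))) = exp (- (Re x * t))" by simp
    moreover have "1 - norm (exp (- (x * of_real t))) \<le> norm (1 + exp (- (x * of_real t)))"
      using norm_diff_ineq[of 1 "exp (- (x * of_real t))"] by simp
    ultimately show ?thesis by linarith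
  qed
qed

text \<open>
  An antiderivative is $-\ln(1+e^{-xt})/x$. The principal branch causes no jump, since
  $|e^{-xt}| < 1$ keeps $1 + e^{-xt}$ in the right half-plane for $t > 0$.
\<close>
lemma inverse_one_plus_exp_greaterThan_0:
  fixes x :: complex
  assumes "Re x > 0"
  shows "set_integrable lborel {0<..} (\<lambda>t. 1 / (1 + exp (x * of_real t)))"
    and "set_lebesgue_integral lborel {0<..} (\<lambda>t. 1 / (1 + exp (x * of_real t))) = of_real (ln 2) / x"
proof -
  obtain \<delta> where \<delta>: "\<delta> > 0" "\<And>t. t \<ge> 0 \<Longrightarrow> \<delta> \<le> norm (1 + exp (- (x * of_real t)))"
    using norm_one_plus_exp_neg_ge[OF assms] by blast
  have nz: "1 + exp (- (x * of_real t)) \<noteq> 0" if "t \<ge> 0" for t using \<delta>(2)[OF that] \<delta>(1) by auto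
  have eq: "1 / (1 + exp (x * of_real t)) = exp (- (x * of_real t)) / (1 + exp (- (x * of_real t)))"
    for t by (simp add: exp_minus divide_simps add.commute)
  have cont: "continuous_on {0<..} (\<lambda>t. 1 / (1 + exp (x * of_real t)))"
    unfolding eq using nz by (auto intro!: continuous_intros)
  show int: "set_integrable lborel {0<..} (\<lambda>t. 1 / (1 + exp (x * of_real t)))"
  proof (rule set_integrable_exp_dominated[where a = "Re x" and C = "1 / \<delta>"])
    fix t :: real assume "t > 0"
    have "norm (exp (- (x * of_real t))) / norm (1 + exp (- (x * of_real t))) \<le> exp (- (Re x * t)) / \<delta>"
      using \<open>t > 0\<close> \<delta> by (intro frac_le) auto
    then show "norm (1 / (1 + exp (x * of_real t))) \<le> 1 / \<delta> * exp (- (Re x * t))"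
      unfolding eq by (simp add: norm_divide)
  qed (use assms cont in auto)
  have x: "x \<noteq> 0" using assms by auto
  define F where "F = (\<lambda>t::real. - ln (1 + exp (- (x * of_real t))) / x)"
  have Re: "1 + exp (- (x * of_real t)) \<notin> \<real>\<^sub>\<le>\<^sub>0" if "t \<ge> 0" for t
  proof (cases "t = 0")
    case False
    have "norm (exp (- (x * of_real t))) < 1" using that False assms by simp
    moreover have "\<bar>Re (exp (- (x * of_real t)))\<bar> \<le> norm (exp (- (x * of_real t)))"
      by (rule abs_Re_le_cmod)
    ultimately have "\<bar>Re (exp (- (x * of_real t)))\<bar> < 1" by linarith
    then have "Re (1 + exp (- (x * of_real t))) > 0" by simp
    then show ?thesis by (auto simp: complex_nonpos_Reals_iff)
  qed (auto simp: complex_nonpos_Reals_iff)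
  have 0: "(F \<longlongrightarrow> F 0) (at_right 0)"
    unfolding F_def using x Re[of 0] by (intro tendsto_intros) auto
  have "((\<lambda>t. exp (- (Re x * t))) \<longlongrightarrow> 0) at_top"
    using assms by real_asymp
  then have "((\<lambda>t. exp (- (x * of_real t))) \<longlongrightarrow> 0) at_top"
    by (subst tendsto_norm_zero_iff [symmetric]) simp
  then have "(F \<longlongrightarrow> - ln (1 + 0) / x) at_top"
    unfolding F_def using x by (intro tendsto_intros) (auto simp: complex_nonpos_Reals_iff)
  then have 1: "(F \<longlongrightarrow> 0) at_top" by simp
  have 2: "(F has_vector_derivative 1 / (1 + exp (x * of_real t))) (at t)" if "t > 0" for t
    unfolding F_def eq using x Re[of t] nz[of t] that
    by (auto intro!: has_vector_derivative_real_field derivative_eq_intros simp: inverse_eq_divide)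
  have 3: "isCont (\<lambda>t. 1 / (1 + exp (x * of_real t))) t" if "t > 0" for t
    using cont that by (simp add: continuous_on_eq_continuous_at)
  have "F 0 = - (of_real (ln 2) / x)" using Ln_of_real[of 2] by (simp add: F_def)
  then show "set_lebesgue_integral lborel {0<..} (\<lambda>t. 1 / (1 + exp (x * of_real t))) = of_real (ln 2) / x"
    using set_integral_FTC_greaterThan[OF 2 3 int 0 1] by simp
qed

section \<open>Doubling the argument of the remainder\<close>

text \<open>
  The logistic function minus its value at $0$. Subtracting that value makes the function vanish
  linearly at $0$, which is what gives its Laplace transform
  the decay $O((\mathrm{Re}\,w)^{-2})$.
\<close>
definition sigmoid_excess :: "real \<Rightarrow> real" where
  "sigmoid_excess t = 1 / (1 + exp (- t)) - 1 / 2"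

lemma sigmoid_excess_bounds:
  assumes "t \<ge> 0"
  shows "0 \<le> sigmoid_excess t" "sigmoid_excess t \<le> 1 / 2" "sigmoid_excess t \<le> t / 2"
proof -
  have p: "exp (- t) > 0" by simp
  then have "2 + 2 * exp (- t) > 0" by linarith
  have eq: "sigmoid_excess t = (1 - exp (- t)) / (2 * (1 + exp (- t)))"
    using add_pos_pos[OF zero_less_one p] unfolding sigmoid_excess_def by (simp add: divide_simps)
  have "exp (- t) \<le> 1" using assms by simp
  then show "0 \<le> sigmoid_excess t"
    unfolding eq using \<open>2 + 2 * exp (- t) > 0\<close> by (intro divide_nonneg_pos) auto
  have "sigmoid_excess t \<le> (1 - exp (- t)) / (2 * 1)"
    unfolding eq using p \<open>exp (- t) \<le> 1\<close> \<open>2 + 2 * exp (- t) > 0\<close> by (intro divide_left_mono mult_left_mono) auto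
  then have "2 * sigmoid_excess t \<le> 1 - exp (- t)" by simp
  with p exp_ge_add_one_self[of "- t"] have "2 * sigmoid_excess t \<le> 1" "2 * sigmoid_excess t \<le> t"
    by linarith+
  then show "sigmoid_excess t \<le> 1 / 2" "sigmoid_excess t \<le> t / 2"
    by simp_all
qed

lemma exp_neg_of_real: "exp (- of_real t) = (of_real (exp (- t)) :: complex)"
  using exp_of_real[of "- t", where 'a = complex] by simp

lemma one_plus_exp_neg_of_real_neq_0: "1 + exp (- of_real t) \<noteq> (0 :: complex)"
proof -
  have "1 + exp (- t) \<noteq> 0" using exp_gt_zero[of "- t"] by linarith
  then have "of_real (1 + exp (- t)) \<noteq> (0 :: complex)" by (simp only: of_real_eq_0_iff) simp
  then show ?thesis by (simp add: exp_neg_of_real)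
qed

lemma of_real_sigmoid_excess:
  "of_real (sigmoid_excess t) = 1 / (1 + exp (- of_real t)) - (1 / 2 :: complex)"
  by (simp add: sigmoid_excess_def exp_neg_of_real)

definition sigmoid_laplace :: "complex \<Rightarrow> complex" where
  "sigmoid_laplace w = set_lebesgue_integral lborel {0<..}
     (\<lambda>t. exp (- (w * of_real t)) / (1 + exp (- of_real t)))"

definition excess_laplace :: "complex \<Rightarrow> complex" where
  "excess_laplace w = set_lebesgue_integral lborel {0<..}
     (\<lambda>t. exp (- (w * of_real t)) * of_real (sigmoid_excess t))"

lemma norm_inverse_one_plus_exp_le_1: "norm (1 / (1 + exp (- of_real t) :: complex)) \<le> 1"
proof -
  have "norm (of_real (1 / (1 + exp (- t))) :: complex) \<le> 1"
    unfolding norm_of_real using exp_gt_zero[of "- t"] by (simp add: field_simps add_pos_pos)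
  then show ?thesis by (simp add: exp_neg_of_real)
qed

lemma set_integrable_sigmoid_laplace:
  assumes "Re w > 0"
  shows "set_integrable lborel {0<..} (\<lambda>t. exp (- (w * of_real t)) / (1 + exp (- of_real t)))"
proof (rule set_integrable_exp_dominated[where a = "Re w" and C = 1])
  show "continuous_on {0<..} (\<lambda>t. exp (- (w * of_real t)) / (1 + exp (- of_real t)))"
    using one_plus_exp_neg_of_real_neq_0 by (intro continuous_intros) auto
  fix t :: real
  show "norm (exp (- (w * of_real t)) / (1 + exp (- of_real t))) \<le> 1 * exp (- (Re w * t))"
    using norm_inverse_one_plus_exp_le_1[of t] mult_left_le[of "norm (1 / (1 + exp (- of_real t) :: complex))" "exp (- (Re w * t))"]
    by (simp add: norm_divide)
qed (use assms in auto)

lemma continuous_on_sigmoid_excess [continuous_intros]: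
  "continuous_on A sigmoid_excess"
proof -
  have "1 + exp (- t) \<noteq> (0 :: real)" for t using exp_gt_zero[of "- t"] by linarith
  then show ?thesis unfolding sigmoid_excess_def by (intro continuous_intros) auto
qed

lemma set_integrable_excess_laplace:
  assumes "Re w > 0"
  shows "set_integrable lborel {0<..} (\<lambda>t. exp (- (w * of_real t)) * of_real (sigmoid_excess t))"
proof (rule set_integrable_exp_dominated[where a = "Re w" and C = "1 / 2"])
  fix t :: real assume "t > 0"
  then show "norm (exp (- (w * of_real t)) * of_real (sigmoid_excess t)) \<le> 1 / 2 * exp (- (Re w * t))"
    using sigmoid_excess_bounds(1,2)[of t] by (simp add: norm_mult)
qed (use assms in \<open>auto intro!: continuous_intros\<close>)

lemma norm_set_integral_le:
  fixes f :: "real \<Rightarrow> complex"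
  assumes "set_integrable lborel A f" "set_integrable lborel A g" "\<And>t. t \<in> A \<Longrightarrow> norm (f t) \<le> g t"
  shows "norm (set_lebesgue_integral lborel A f) \<le> set_lebesgue_integral lborel A g"
  using set_integral_norm_bound[OF assms(1)]
    set_integral_mono[OF set_integrable_norm[OF assms(1)] assms(2,3)] by linarith

lemma norm_sigmoid_laplace_le:
  assumes "Re w > 0"
  shows "norm (sigmoid_laplace w) \<le> 1 / Re w"
proof -
  have "norm (exp (- (w * of_real t)) / (1 + exp (- of_real t))) \<le> exp (- (Re w * t))" for t :: real
    using norm_inverse_one_plus_exp_le_1[of t] mult_left_le[of "norm (1 / (1 + exp (- of_real t) :: complex))" "exp (- (Re w * t))"]
    by (simp add: norm_divide)
  then show ?thesis
    unfolding sigmoid_laplace_def exp_real_greaterThan_0(2)[OF assms, symmetric]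
    by (intro norm_set_integral_le set_integrable_sigmoid_laplace exp_real_greaterThan_0 assms)
qed

lemma norm_excess_laplace_le:
  assumes "Re w > 0"
  shows "norm (excess_laplace w) \<le> 1 / (2 * Re w ^ 2)"
proof -
  have "norm (excess_laplace w) \<le> set_lebesgue_integral lborel {0<..} (\<lambda>t. 1 / 2 * (t * exp (- (Re w * t))))"
    unfolding excess_laplace_def
  proof (intro norm_set_integral_le set_integrable_excess_laplace set_integrable_mult_right mult_exp_real_greaterThan_0 assms)
    fix t :: real assume "t \<in> {0<..}"
    then show "norm (exp (- (w * of_real t)) * of_real (sigmoid_excess t)) \<le> 1 / 2 * (t * exp (- (Re w * t)))"
      using sigmoid_excess_bounds(1,3)[of t] by (simp add: norm_mult)
  qed
  then show ?thesis
    using mult_exp_real_greaterThan_0(2)[OF assms] by simp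
qed

text \<open>
  The factor $1 + e^{-t}$ produced by adding the two transforms cancels the denominator.
\<close>
lemma sigmoid_laplace_functional_equation:
  assumes "Re w > 0"
  shows "sigmoid_laplace w + sigmoid_laplace (w + 1) = 1 / w"
proof -
  have "sigmoid_laplace w + sigmoid_laplace (w + 1) = set_lebesgue_integral lborel {0<..}
     (\<lambda>t. exp (- (w * of_real t)) / (1 + exp (- of_real t)) + exp (- ((w + 1) * of_real t)) / (1 + exp (- of_real t)))"
    unfolding sigmoid_laplace_def using assms
    by (intro set_integral_add(2)[symmetric] set_integrable_sigmoid_laplace) auto
  also have "(\<lambda>t. exp (- (w * of_real t)) / (1 + exp (- of_real t)) + exp (- ((w + 1) * of_real t)) / (1 + exp (- of_real t)))
     = (\<lambda>t::real. exp (- (w * of_real t)))"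
  proof
    fix t :: real
    have "exp (- ((w + 1) * of_real t)) = exp (- (w * of_real t)) * exp (- of_real t)"
      by (simp add: exp_add [symmetric] algebra_simps)
    then show "exp (- (w * of_real t)) / (1 + exp (- of_real t)) + exp (- ((w + 1) * of_real t)) / (1 + exp (- of_real t))
        = exp (- (w * of_real t))"
      using one_plus_exp_neg_of_real_neq_0[of t] by (simp add: add_divide_distrib [symmetric] divide_eq_eq distrib_left)
  qed
  finally show ?thesis using exp_complex_greaterThan_0(2)[OF assms] by simp
qed

lemma excess_laplace_eq:
  assumes "Re w > 0"
  shows "excess_laplace w = sigmoid_laplace w - 1 / (2 * w)"
proof -
  have "sigmoid_laplace w - 1 / 2 * (1 / w) = set_lebesgue_integral lborel {0<..}
     (\<lambda>t. exp (- (w * of_real t)) / (1 + exp (- of_real t)) - 1 / 2 * exp (- (w * of_real t)))"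
    unfolding sigmoid_laplace_def exp_complex_greaterThan_0(2)[OF assms, symmetric] set_integral_mult_right [symmetric]
    using assms
    by (intro set_integral_diff(2)[symmetric] set_integrable_sigmoid_laplace set_integrable_mult_right exp_complex_greaterThan_0(1)) auto
  also have "\<dots> = excess_laplace w"
    unfolding excess_laplace_def by (simp add: of_real_sigmoid_excess algebra_simps)
  finally show ?thesis by simp
qed

lemma sum_lessThan_double:
  fixes f :: "nat \<Rightarrow> 'a::comm_monoid_add"
  shows "(\<Sum>n<2 * m. f n) = (\<Sum>n<m. f (2 * n) + f (2 * n + 1))"
  by (induction m) (simp_all add: add_ac)

text \<open>
  In Gauss's limit for $\psi(w)$ with $2m$ terms and for $\psi(w/2)$ with $m$ terms, the terms
  of the second sum are twice the even-indexed terms of the first. The difference is therefore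
  $\ln 2$ plus the alternating series $\sum (-1)^n/(w+n)$, and the functional equation of
  \<^const>\<open>sigmoid_laplace\<close>, used twice, telescopes this series to \<^term>\<open>sigmoid_laplace w\<close>.
\<close>
lemma Digamma_minus_Digamma_half:
  assumes "Re w > 0"
  shows "Digamma w - Digamma (w / 2) = sigmoid_laplace w + of_real (ln 2)"
proof -
  have nz: "w + of_nat n \<noteq> 0" for n using assms by (auto simp: complex_eq_iff)
  have tele: "sigmoid_laplace w - sigmoid_laplace (w + of_nat (2 * m))
     = (\<Sum>n<m. inverse (w + of_nat (2 * n)) - inverse (w + of_nat (2 * n + 1)))" for m
  proof (induction m)
    case (Suc m)
    define v where "v = w + of_nat (2 * m)"
    have v: "Re v > 0" using assms by (simp add: v_def add_pos_nonneg)
    have "sigmoid_laplace v - sigmoid_laplace (v + 2) =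
        (sigmoid_laplace v + sigmoid_laplace (v + 1)) - (sigmoid_laplace (v + 1) + sigmoid_laplace (v + 1 + 1))"
      by (simp add: add.assoc)
    also have "\<dots> = inverse v - inverse (v + 1)"
      using v by (simp only: sigmoid_laplace_functional_equation plus_complex.sel one_complex.sel
          inverse_eq_divide add_pos_pos zero_less_one)
    finally have "sigmoid_laplace v - sigmoid_laplace (v + 2) = inverse v - inverse (v + 1)" .
    with Suc show ?case by (simp add: v_def algebra_simps)
  qed auto
  have "(\<lambda>m. sigmoid_laplace (w + of_nat (2 * m))) \<longlonglongrightarrow> 0"
  proof (rule tendsto_norm_zero_cancel, rule tendsto_sandwich[OF _ _ tendsto_const])
    show "(\<lambda>m. 1 / (Re w + real (2 * m))) \<longlonglongrightarrow> 0" by real_asymp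
    show "\<forall>\<^sub>F m in sequentially. norm (sigmoid_laplace (w + of_nat (2 * m))) \<le> 1 / (Re w + real (2 * m))"
      using norm_sigmoid_laplace_le[of "w + of_nat (2 * m)" for m] assms
      by (intro always_eventually) (auto simp: add_pos_nonneg)
  qed auto
  then have "(\<lambda>m. sigmoid_laplace w - sigmoid_laplace (w + of_nat (2 * m))) \<longlonglongrightarrow> sigmoid_laplace w - 0"
    by (intro tendsto_intros)
  then have 1: "(\<lambda>m. \<Sum>n<m. inverse (w + of_nat (2 * n)) - inverse (w + of_nat (2 * n + 1))) \<longlonglongrightarrow> sigmoid_laplace w"
    unfolding tele by simp
  have "filterlim (\<lambda>m::nat. 2 * m) at_top sequentially" by real_asymp
  from filterlim_compose[OF Digamma_LIMSEQ[of w] this]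
  have A: "(\<lambda>m. of_real (ln (real (2 * m))) - (\<Sum>n<2 * m. inverse (w + of_nat n))) \<longlonglongrightarrow> Digamma w"
    using nz[of 0] by simp
  have B: "(\<lambda>m. of_real (ln (real m)) - (\<Sum>n<m. inverse (w / 2 + of_nat n))) \<longlonglongrightarrow> Digamma (w / 2)"
    using nz[of 0] by (intro Digamma_LIMSEQ) auto
  have "(\<lambda>m. (of_real (ln (real (2 * m))) - (\<Sum>n<2 * m. inverse (w + of_nat n))) -
             (of_real (ln (real m)) - (\<Sum>n<m. inverse (w / 2 + of_nat n))) - of_real (ln 2))
           \<longlonglongrightarrow> Digamma w - Digamma (w / 2) - of_real (ln 2)"
    by (intro tendsto_intros A B)
  moreover have "\<forall>\<^sub>F m in sequentially. (of_real (ln (real (2 * m))) - (\<Sum>n<2 * m. inverse (w + of_nat n))) -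
             (of_real (ln (real m)) - (\<Sum>n<m. inverse (w / 2 + of_nat n))) - of_real (ln 2)
       = (\<Sum>n<m. inverse (w + of_nat (2 * n)) - inverse (w + of_nat (2 * n + 1)))"
    using eventually_gt_at_top[of 0]
  proof eventually_elim
    case (elim m)
    have "inverse (w / 2 + of_nat n) = 2 * inverse (w + of_nat (2 * n))" for n
      using nz[of "2 * n"] by (simp add: field_simps)
    then have "(\<Sum>n<m. inverse (w / 2 + of_nat n)) - (\<Sum>n<2 * m. inverse (w + of_nat n))
      = (\<Sum>n<m. inverse (w + of_nat (2 * n)) - inverse (w + of_nat (2 * n + 1)))"
      unfolding sum_lessThan_double sum_subtractf [symmetric] by (intro sum.cong) auto
    moreover have "ln (real (2 * m)) = ln 2 + ln (real m)" using elim by (simp add: ln_mult)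
    ultimately show ?case by (simp add: algebra_simps)
  qed
  ultimately have "(\<lambda>m. \<Sum>n<m. inverse (w + of_nat (2 * n)) - inverse (w + of_nat (2 * n + 1)))
     \<longlonglongrightarrow> Digamma w - Digamma (w / 2) - of_real (ln 2)"
    by (rule Lim_transform_eventually)
  from LIMSEQ_unique[OF this 1] show ?thesis by (simp add: algebra_simps)
qed

text \<open>
  Under doubling the logarithms cancel up to the constant $\ln 2$, which also appears in the
  difference of the digamma values; what is left is a Laplace transform with a bounded kernel.
\<close>
lemma digamma_rem_double:
  assumes "Re z > 0"
  shows "digamma_rem (2 * z) - digamma_rem z = excess_laplace (2 * z)"
proof -
  have z: "z \<noteq> 0" using assms by auto
  have "ln (2 * z) = ln 2 + ln z" using assms by (intro ln_mult_Re_pos) auto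
  moreover have "ln (2 :: complex) = of_real (ln 2)" using Ln_of_real[of 2] by simp
  ultimately show ?thesis
    using Digamma_minus_Digamma_half[of "2 * z"] excess_laplace_eq[of "2 * z"] assms z
    by (simp add: digamma_rem_def algebra_simps)
qed

section \<open>Summation over the multiples of the argument\<close>

text \<open>
  Summation under the integral uses this geometric series with $y = e^{-xt}$, for which
  $y/(1+y) = 1/(1+e^{xt})$.
\<close>
lemma sums_geometric_minus_even_powers:
  fixes y :: complex
  assumes "norm y < 1"
  shows "(\<lambda>k. y ^ Suc k - 2 * (y ^ 2) ^ Suc k) sums (y / (1 + y))"
    and "summable (\<lambda>k. norm (y ^ Suc k - 2 * (y ^ 2) ^ Suc k))"
proof -
  have y2: "norm (y ^ 2) < 1" using assms by (simp add: norm_power power_less_one_iff)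
  have y: "1 - y \<noteq> 0" "1 + y \<noteq> 0"
    using assms by (auto simp: add_eq_0_iff dest: sym)
  have "(\<lambda>k. y * y ^ k - 2 * (y ^ 2 * (y ^ 2) ^ k)) sums (y * (1 / (1 - y)) - 2 * (y ^ 2 * (1 / (1 - y ^ 2))))"
    by (intro sums_diff sums_mult geometric_sums assms y2)
  moreover have "1 - y ^ 2 = (1 - y) * (1 + y)" by (simp add: power2_eq_square algebra_simps)
  then have "y * (1 / (1 - y)) - 2 * (y ^ 2 * (1 / (1 - y ^ 2))) = y / (1 + y)"
    using y by (simp add: divide_simps) (simp add: power2_eq_square algebra_simps)
  ultimately show "(\<lambda>k. y ^ Suc k - 2 * (y ^ 2) ^ Suc k) sums (y / (1 + y))" by simp
  show "summable (\<lambda>k. norm (y ^ Suc k - 2 * (y ^ 2) ^ Suc k))"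
  proof (rule summable_comparison_test)
    show "summable (\<lambda>k. norm y * norm y ^ k + 2 * (norm (y ^ 2) * norm (y ^ 2) ^ k))"
      using assms y2 by (intro summable_add summable_mult summable_geometric) auto
    show "\<exists>N. \<forall>k\<ge>N. norm (norm (y ^ Suc k - 2 * (y ^ 2) ^ Suc k))
        \<le> norm y * norm y ^ k + 2 * (norm (y ^ 2) * norm (y ^ 2) ^ k)"
    proof (intro exI allI impI)
      fix k
      show "norm (norm (y ^ Suc k - 2 * (y ^ 2) ^ Suc k))
        \<le> norm y * norm y ^ k + 2 * (norm (y ^ 2) * norm (y ^ 2) ^ k)"
        using norm_triangle_ineq4[of "y ^ Suc k" "2 * (y ^ 2) ^ Suc k"]
        by (simp add: norm_mult norm_power)
    qed
  qed
qed

text \<open>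
  Sum and integral may be exchanged because the linear bound on \<^const>\<open>sigmoid_excess\<close> gives the
  $k$-th term an $L^1$ norm of order $1/(k+1)^2$.
\<close>
lemma sums_excess_laplace:
  assumes "Re x > 0"
  shows "(\<lambda>k. excess_laplace (of_nat (Suc k) * x) - 2 * excess_laplace (2 * (of_nat (Suc k) * x))) sums
    set_lebesgue_integral lborel {0<..} (\<lambda>t. of_real (sigmoid_excess t) / (1 + exp (x * of_real t)))"
proof -
  define h where "h = (\<lambda>k t. exp (- (of_nat (Suc k) * x * of_real t)) * complex_of_real (sigmoid_excess t)
      - 2 * (exp (- (2 * (of_nat (Suc k) * x) * of_real t)) * of_real (sigmoid_excess t)))"
  have Re: "Re (of_nat (Suc k) * x) > 0" for k using assms by (simp add: add_pos_nonneg)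
  have Re2: "Re (2 * (of_nat (Suc k) * x)) > 0" for k using Re[of k] by simp
  have int: "set_integrable lborel {0<..} (h k)" for k
    unfolding h_def using Re[of k] Re2[of k]
    by (intro set_integral_diff(1) set_integrable_mult_right set_integrable_excess_laplace)
  have I: "set_lebesgue_integral lborel {0<..} (h k)
      = excess_laplace (of_nat (Suc k) * x) - 2 * excess_laplace (2 * (of_nat (Suc k) * x))" for k
    unfolding h_def excess_laplace_def set_integral_mult_right [symmetric]
    using Re[of k] Re2[of k]
    by (intro set_integral_diff(2) set_integrable_mult_right set_integrable_excess_laplace)
  have hy: "h k t = (exp (- (x * of_real t)) ^ Suc k - 2 * (exp (- (x * of_real t)) ^ 2) ^ Suc k) * of_real (sigmoid_excess t)"
    for k t
  proof -
    have "exp (- (of_nat (Suc k) * x * of_real t)) = exp (- (x * of_real t)) ^ Suc k"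
      by (simp only: exp_of_nat_mult [symmetric]) (simp add: algebra_simps)
    moreover have "exp (- (2 * (of_nat (Suc k) * x) * of_real t)) = (exp (- (x * of_real t)) ^ 2) ^ Suc k"
      unfolding power_mult [symmetric]
      by (simp only: exp_of_nat_mult [symmetric]) (simp add: algebra_simps)
    ultimately show ?thesis by (simp only: h_def left_diff_distrib mult.assoc)
  qed
  have ylt: "norm (exp (- (x * of_real t))) < 1" if "t > 0" for t :: real using that assms by simp
  have hsums: "(\<lambda>k. h k t) sums (of_real (sigmoid_excess t) / (1 + exp (x * of_real t)))" if "t > 0" for t
  proof -
    have "exp (- (x * of_real t)) / (1 + exp (- (x * of_real t))) = 1 / (1 + exp (x * of_real t))"
      by (simp add: exp_minus divide_simps add.commute)
    with sums_mult2[OF sums_geometric_minus_even_powers(1)[OF ylt[OF that]], of "of_real (sigmoid_excess t)"]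
    show ?thesis unfolding hy by simp
  qed
  have hnorm: "summable (\<lambda>k. norm (h k t))" if "t > 0" for t
    using summable_mult2[OF sums_geometric_minus_even_powers(2)[OF ylt[OF that]], of "norm (complex_of_real (sigmoid_excess t))"]
    unfolding hy norm_mult .
  have bound: "set_lebesgue_integral lborel {0<..} (\<lambda>t. norm (h k t)) \<le> (3 / 2) / (real (Suc k) * Re x) ^ 2" for k
  proof -
    define a where "a = real (Suc k) * Re x"
    have a: "a > 0" using Re[of k] by (simp add: a_def)
    have "set_lebesgue_integral lborel {0<..} (\<lambda>t. norm (h k t))
        \<le> set_lebesgue_integral lborel {0<..} (\<lambda>t. (3 / 2) * (t * exp (- (a * t))))"
    proof (intro set_integral_mono set_integrable_norm int set_integrable_mult_right mult_exp_real_greaterThan_0 a)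
      fix t :: real assume "t \<in> {0<..}"
      then have t: "t > 0" by simp
      have "norm (h k t) \<le> (exp (- (a * t)) + 2 * exp (- (2 * a * t))) * sigmoid_excess t"
        using sigmoid_excess_bounds(1)[of t] t
          norm_triangle_ineq4[of "exp (- (of_nat (Suc k) * x * of_real t)) * complex_of_real (sigmoid_excess t)"
            "2 * (exp (- (2 * (of_nat (Suc k) * x) * of_real t)) * of_real (sigmoid_excess t))"]
        by (simp add: h_def norm_mult a_def algebra_simps)
      also have "\<dots> \<le> (exp (- (a * t)) + 2 * exp (- (a * t))) * (t / 2)"
        using sigmoid_excess_bounds(1,3)[of t] t a by (intro mult_mono add_mono mult_left_mono) auto
      finally show "norm (h k t) \<le> (3 / 2) * (t * exp (- (a * t)))" by (simp add: mult_ac)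
    qed
    also have "\<dots> = (3 / 2) / a ^ 2"
      using mult_exp_real_greaterThan_0(2)[OF a] by simp
    finally show ?thesis by (simp add: a_def)
  qed
  have "(\<lambda>k. integral\<^sup>L lborel (\<lambda>t. indicator {0<..} t *\<^sub>R h k t)) sums
      (\<integral>t. (\<Sum>k. indicator {0<..} t *\<^sub>R h k t) \<partial>lborel)"
  proof (rule sums_integral)
    show "integrable lborel (\<lambda>t. indicator {0<..} t *\<^sub>R h k t)" for k
      using int[of k] by (simp add: set_integrable_def)
    show "AE t in lborel. summable (\<lambda>k. norm (indicator {0<..} t *\<^sub>R h k t))"
      using hnorm by (auto simp: indicator_def)
    show "summable (\<lambda>k. \<integral>t. norm (indicator {0<..} t *\<^sub>R h k t) \<partial>lborel)"
    proof (rule summable_comparison_test)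
      show "\<exists>N. \<forall>k\<ge>N. norm (\<integral>t. norm (indicator {0<..} t *\<^sub>R h k t) \<partial>lborel)
          \<le> (3 / 2) / (real (Suc k) * Re x) ^ 2"
        using bound by (auto simp: set_lebesgue_integral_def)
    qed (rule summable_inverse_Suc_squared)
  qed
  moreover have "(\<lambda>t. \<Sum>k. indicator {0<..} t *\<^sub>R h k t)
      = (\<lambda>t. indicator {0<..} t *\<^sub>R (of_real (sigmoid_excess t) / (1 + exp (x * of_real t))))"
    using hsums by (auto simp: indicator_def sums_iff)
  ultimately show ?thesis
    unfolding I [symmetric] by (simp add: set_lebesgue_integral_def)
qed

lemma set_integrable_J1:
  assumes "Re x > 0"
  shows "set_integrable lborel {0<..} (\<lambda>t. 1 / ((1 + exp (- of_real t)) * (1 + exp (x * of_real t))))"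
proof (rule set_integrable_bound)
  show int: "set_integrable lborel {0<..} (\<lambda>t. 1 / (1 + exp (x * of_real t)))"
    by (rule inverse_one_plus_exp_greaterThan_0[OF assms])
  have "set_borel_measurable lborel {0<..} (\<lambda>t. 1 / (1 + exp (- complex_of_real t)) * (1 / (1 + exp (x * of_real t))))"
    unfolding set_borel_measurable_def by measurable
  then show "set_borel_measurable lborel {0<..} (\<lambda>t. 1 / ((1 + exp (- of_real t)) * (1 + exp (x * of_real t))))"
    by simp
  have "norm (1 / (1 + exp (- of_real t) :: complex)) * norm (1 / (1 + exp (x * of_real t)))
      \<le> 1 * norm (1 / (1 + exp (x * of_real t)))" for t :: real
    by (intro mult_right_mono norm_inverse_one_plus_exp_le_1) auto
  then show "AE t in lborel. t \<in> {0<..} \<longrightarrow> norm (1 / ((1 + exp (- of_real t)) * (1 + exp (x * of_real t))))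
     \<le> norm (1 / (1 + exp (x * of_real t)))"
    by (simp add: norm_divide norm_mult)
qed

text \<open>
  Splitting the logistic factor of \<^const>\<open>J1\<close> into its value $1/2$ at the origin and the excess
  separates off half of the elementary integral $\ln 2/x$.
\<close>
lemma J1_sums:
  assumes "Re x > 0"
  shows "(\<lambda>k. excess_laplace (of_nat (Suc k) * x) - 2 * excess_laplace (2 * (of_nat (Suc k) * x))) sums
    (J1 x - of_real (ln 2) / (2 * x))"
proof -
  have "J1 x - 1 / 2 * (of_real (ln 2) / x) = set_lebesgue_integral lborel {0<..}
      (\<lambda>t. 1 / ((1 + exp (- of_real t)) * (1 + exp (x * of_real t))) - 1 / 2 * (1 / (1 + exp (x * of_real t))))"
    unfolding J1_def inverse_one_plus_exp_greaterThan_0(2)[OF assms, symmetric] set_integral_mult_right [symmetric]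
    by (intro set_integral_diff(2)[symmetric] set_integrable_J1 set_integrable_mult_right
        inverse_one_plus_exp_greaterThan_0(1) assms)
  also have "(\<lambda>t::real. 1 / ((1 + exp (- of_real t)) * (1 + exp (x * of_real t))) - 1 / 2 * (1 / (1 + exp (x * of_real t))))
      = (\<lambda>t. of_real (sigmoid_excess t) / (1 + exp (x * of_real t)))"
    by (simp add: of_real_sigmoid_excess diff_divide_distrib)
  finally show ?thesis using sums_excess_laplace[OF assms] by simp
qed

lemma ln_two_pi_over_scaled:
  fixes x :: complex
  assumes "Re x > 0" "c > 0"
  shows "ln (2 * of_real pi / (of_real c * x)) = ln (2 * of_real pi / x) - of_real (ln c)"
proof -
  have "x \<noteq> 0" using assms by auto
  have p: "Re (2 * of_real pi / (of_real c * x)) > 0"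
  proof -
    have "2 * of_real pi / (of_real c * x) = of_real (2 * pi / c) * (1 / x)" by simp
    then have "Re (2 * of_real pi / (of_real c * x)) = (2 * pi / c) * Re (1 / x)"
      by (simp only: times_complex.sel Re_complex_of_real Im_complex_of_real mult_zero_left diff_zero)
    also have "\<dots> > 0" using Re_inverse_pos[of x] assms by (intro mult_pos_pos divide_pos_pos) auto
    finally show ?thesis .
  qed
  have "ln (of_real c * (2 * of_real pi / (of_real c * x))) = ln (of_real c) + ln (2 * of_real pi / (of_real c * x))"
    using assms p by (intro ln_mult_Re_pos) auto
  moreover have "of_real c * (2 * of_real pi / (of_real c * x)) = 2 * of_real pi / x" using assms by simp
  moreover have "ln (complex_of_real c) = of_real (ln c)" using assms by (simp add: Ln_of_real)
  ultimately show ?thesis by simp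
qed

lemma calF1_sums:
  assumes "Re x > 0"
  shows "(\<lambda>k. digamma_rem (of_nat (Suc k) * x)) sums
    (calF1 x + 1 / 2 * (euler_mascheroni - ln (2 * of_real pi / x)))"
  using summable_sums[OF summable_digamma_rem[OF assms]]
  by (simp add: calF1_def digamma_rem_def mult.assoc del: of_nat_Suc)

text \<open>
  With $R$ = \<^const>\<open>digamma_rem\<close> and $w = (k+1)x$, the terms regroup as
  \[ 3R(w) - 2R(2w) - R(w/2) = (R(w) - R(w/2)) - 2\,(R(2w) - R(w)), \]
  so only differences under doubling occur. The Euler constants cancel since $3 - 2 - 1 = 0$,
  and the logarithms of $2\pi/x$ leave a multiple of $\ln 2$.
\<close>
lemma calJ1_eq_calF1:
  assumes "Re x > 0"
  shows "calJ1 x = 3 * calF1 x - 2 * calF1 (2 * x) - calF1 (x / 2) + (1 + x) / (2 * x) * of_real (ln 2)"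
proof -
  have x: "x \<noteq> 0" using assms by auto
  define h :: complex where "h = of_real (ln 2) / 2"
  define L where "L = ln (2 * of_real pi / x)"
  have "Re (2 * x) > 0" "Re (x / 2) > 0" using assms by auto
  note S = calF1_sums[OF assms] calF1_sums[OF this(1)] calF1_sums[OF this(2)]
  have L2: "ln (2 * of_real pi / (2 * x)) = L - of_real (ln 2)"
    using ln_two_pi_over_scaled[OF assms, of 2] by (simp add: L_def)
  have L3: "ln (2 * of_real pi / (x / 2)) = L + of_real (ln 2)"
    using ln_two_pi_over_scaled[OF assms, of "1 / 2"] by (simp add: L_def ln_div)
  have "(\<lambda>k. 3 * digamma_rem (of_nat (Suc k) * x) - 2 * digamma_rem (of_nat (Suc k) * (2 * x))
           - digamma_rem (of_nat (Suc k) * (x / 2))) sums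
        (3 * (calF1 x + 1 / 2 * (euler_mascheroni - ln (2 * of_real pi / x)))
         - 2 * (calF1 (2 * x) + 1 / 2 * (euler_mascheroni - ln (2 * of_real pi / (2 * x))))
         - (calF1 (x / 2) + 1 / 2 * (euler_mascheroni - ln (2 * of_real pi / (x / 2)))))"
    by (intro sums_diff sums_mult S)
  moreover have "3 * digamma_rem (of_nat (Suc k) * x) - 2 * digamma_rem (of_nat (Suc k) * (2 * x))
           - digamma_rem (of_nat (Suc k) * (x / 2))
      = excess_laplace (of_nat (Suc k) * x) - 2 * excess_laplace (2 * (of_nat (Suc k) * x))" for k
  proof -
    define w where "w = of_nat (Suc k) * x"
    have w: "Re w > 0" using assms by (simp add: w_def add_pos_nonneg)
    have "digamma_rem w - digamma_rem (w / 2) = excess_laplace w"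
      using digamma_rem_double[of "w / 2"] w by simp
    moreover have "digamma_rem (2 * w) - digamma_rem w = excess_laplace (2 * w)"
      using digamma_rem_double[OF w] .
    moreover have "of_nat (Suc k) * (2 * x) = 2 * w" "of_nat (Suc k) * (x / 2) = w / 2"
      by (simp_all add: w_def)
    ultimately show ?thesis unfolding w_def [symmetric] by (simp only:) (simp add: algebra_simps)
  qed
  ultimately have "J1 x - of_real (ln 2) / (2 * x) =
        3 * (calF1 x + 1 / 2 * (euler_mascheroni - L))
         - 2 * (calF1 (2 * x) + 1 / 2 * (euler_mascheroni - (L - of_real (ln 2))))
         - (calF1 (x / 2) + 1 / 2 * (euler_mascheroni - (L + of_real (ln 2))))"
    using sums_unique2[OF J1_sums[OF assms]] unfolding L2 L3 L_def [symmetric] by (simp only:)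
  then have "J1 x = of_real (ln 2) / (2 * x) + 3 * calF1 x - 2 * calF1 (2 * x) - calF1 (x / 2) - h"
    unfolding h_def by (simp add: algebra_simps add_divide_distrib diff_divide_distrib)
  moreover have "(1 + x) / (2 * x) * of_real (ln 2) = of_real (ln 2) / (2 * x) + h"
    unfolding h_def using x by (simp add: field_simps)
  moreover have "calJ1 x = J1 x + (h + h)"
    by (simp add: calJ1_def h_def)
  ultimately show ?thesis by (simp only: algebra_simps)
qed

section \<open>The reciprocity relation\<close>

text \<open>
  For real $r$ the substitution $t = ru$ is available. With $a = 1/(1+e^{-u})$ and
  $b = 1/(1+e^{ru})$ it turns the integrand for $1/r$ into $(1-a)(1-b) = ab + (1-a) - b$, so the two
  integrals differ only by elementary ones.
\<close>
lemma calJ1_reciprocal_real: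
  assumes "r > 0"
  shows "calJ1 (of_real r) - 1 / of_real r * calJ1 (1 / of_real r) = 0"
proof -
  let ?I = "\<lambda>f. set_lebesgue_integral lborel {0<..} (f :: real \<Rightarrow> complex)"
  have "J1 (1 / of_real r) = of_real r * ?I (\<lambda>u. 1 / ((1 + exp (- of_real (r * u))) * (1 + exp (of_real u))))"
    unfolding J1_def set_lebesgue_integral_def
    by (subst lborel_integral_real_affine[where c = r and t = 0])
       (use assms in \<open>simp_all add: scaleR_conv_of_real indicator_def zero_less_mult_iff\<close>)
  moreover have "?I (\<lambda>u. 1 / ((1 + exp (- of_real (r * u))) * (1 + exp (of_real u))))
      = ?I (\<lambda>u. (1 / ((1 + exp (- of_real u)) * (1 + exp (of_real r * of_real u))) + 1 / (1 + exp (1 * of_real u)))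
           - 1 / (1 + exp (of_real r * of_real u)))"
  proof (intro arg_cong[of _ _ ?I] ext)
    fix u :: real
    define A B where "A = exp (complex_of_real u)" and "B = exp (complex_of_real (r * u))"
    have nz: "A \<noteq> 0" "B \<noteq> 0" by (auto simp: A_def B_def)
    have nz1: "1 + A \<noteq> 0" "1 + B \<noteq> 0"
      using one_plus_exp_neg_of_real_neq_0[of "- u"] one_plus_exp_neg_of_real_neq_0[of "- (r * u)"]
      by (auto simp: A_def B_def)
    have "1 / ((1 + 1 / B) * (1 + A)) = B / ((1 + B) * (1 + A))" "1 / ((1 + 1 / A) * (1 + B)) = A / ((1 + A) * (1 + B))"
      using nz nz1 by (simp_all add: divide_simps add.commute)
    moreover have "B / ((1 + B) * (1 + A)) = (A / ((1 + A) * (1 + B)) + 1 / (1 + A)) - 1 / (1 + B)"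
      using nz1 by (simp add: divide_simps)
    ultimately have "1 / ((1 + 1 / B) * (1 + A)) = (1 / ((1 + 1 / A) * (1 + B)) + 1 / (1 + A)) - 1 / (1 + B)"
      by simp
    then show "1 / ((1 + exp (- of_real (r * u))) * (1 + exp (of_real u)))
      = (1 / ((1 + exp (- of_real u)) * (1 + exp (of_real r * of_real u))) + 1 / (1 + exp (1 * of_real u)))
           - 1 / (1 + exp (of_real r * of_real u) :: complex)"
      by (simp add: A_def B_def exp_minus inverse_eq_divide)
  qed
  moreover have "\<dots> = J1 (of_real r) + of_real (ln 2) / 1 - of_real (ln 2) / of_real r"
  proof -
    have pos: "Re (of_real r) > 0" "Re 1 > 0" using assms by simp_all
    note int = set_integrable_J1[OF pos(1)] inverse_one_plus_exp_greaterThan_0(1)[OF pos(1)]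
      inverse_one_plus_exp_greaterThan_0(1)[OF pos(2)]
    show ?thesis
      unfolding set_integral_diff(2)[OF set_integral_add(1)[OF int(1,3)] int(2)] set_integral_add(2)[OF int(1,3)]
        inverse_one_plus_exp_greaterThan_0(2)[OF pos(1)] inverse_one_plus_exp_greaterThan_0(2)[OF pos(2)] J1_def ..
  qed
  ultimately have "J1 (1 / of_real r) = of_real r * (J1 (of_real r) + of_real (ln 2) - of_real (ln 2) / of_real r)"
    by simp
  then have "calJ1 (1 / of_real r) = of_real r * calJ1 (of_real r)"
    using assms by (simp add: calJ1_def distrib_left right_diff_distrib)
  then show ?thesis using assms by simp
qed

text \<open>
  Instead of differentiating under the integral sign, the series representation is used: its terms are
  combinations of digamma functions, and on $\mathrm{Re}\,x \geq a$ the $k$-th term is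
  $O(((k+1)a)^{-2})$, so the convergence is locally uniform.
\<close>
lemma calJ1_holomorphic: "calJ1 holomorphic_on {x. Re x > 0}"
proof -
  define S where "S = {x. Re x > 0}"
  define d where "d = (\<lambda>k x. excess_laplace (of_nat (Suc k) * x) - 2 * excess_laplace (2 * (of_nat (Suc k) * x)))"
  have excess_hol: "excess_laplace holomorphic_on S"
  proof -
    have "(\<lambda>w. Digamma w - Digamma (w / 2) - of_real (ln 2) - 1 / (2 * w)) holomorphic_on S"
      by (auto intro!: holomorphic_intros holomorphic_on_compose_gen[of "\<lambda>w. w / 2" _ Digamma S, unfolded o_def]
          simp: S_def elim!: nonpos_Ints_cases)
    then show ?thesis
      by (rule holomorphic_transform) (simp add: S_def excess_laplace_eq Digamma_minus_Digamma_half)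
  qed
  have comp: "(\<lambda>x. excess_laplace (of_real c * x)) holomorphic_on S" if "c > 0" for c
    using that by (intro holomorphic_on_compose_gen[of "\<lambda>x. of_real c * x" _ excess_laplace S, unfolded o_def]
        excess_hol holomorphic_intros) (auto simp: S_def)
  have d_hol: "d k holomorphic_on S" for k
    using comp[of "real (Suc k)"] comp[of "2 * real (Suc k)"] unfolding d_def
    by (intro holomorphic_intros) (auto simp: mult.assoc simp del: of_nat_Suc)
  have bound: "norm (d k x) \<le> 1 / (real (Suc k) * a) ^ 2" if "a > 0" "Re x \<ge> a" for k x a
  proof -
    define b where "b = real (Suc k) * Re x"
    have "real (Suc k) * a > 0" using that by (intro mult_pos_pos) auto
    have ab: "real (Suc k) * a \<le> b" unfolding b_def using that by (intro mult_left_mono) auto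
    then have b: "b > 0" using \<open>real (Suc k) * a > 0\<close> by linarith
    have "norm (d k x) \<le> norm (excess_laplace (of_nat (Suc k) * x)) + norm (2 * excess_laplace (2 * (of_nat (Suc k) * x)))"
      unfolding d_def by (rule norm_triangle_ineq4)
    also have "\<dots> \<le> 1 / (2 * b ^ 2) + 2 * (1 / (2 * (2 * b) ^ 2))"
    proof -
      have "Re (of_nat (Suc k) * x) = b" "Re (2 * (of_nat (Suc k) * x)) = 2 * b"
        by (simp_all add: b_def)
      then show ?thesis
        using norm_excess_laplace_le[of "of_nat (Suc k) * x"] norm_excess_laplace_le[of "2 * (of_nat (Suc k) * x)"] b
        unfolding norm_mult by (intro add_mono) (simp_all only:, simp_all)
    qed
    also have "\<dots> \<le> 1 / b ^ 2" using b by (simp add: field_simps)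
    also have "\<dots> \<le> 1 / (real (Suc k) * a) ^ 2"
      using ab b that by (intro divide_left_mono power_mono mult_pos_pos zero_less_power) auto
    finally show ?thesis .
  qed
  have op: "open S" unfolding S_def by (rule open_halfspace_Re_gt)
  have "(\<lambda>x. \<Sum>k. d k x) holomorphic_on S"
  proof (rule holomorphic_uniform_sequence[OF op])
    show "(\<lambda>x. \<Sum>k<n. d k x) holomorphic_on S" for n by (intro holomorphic_intros d_hol)
    fix x assume x: "x \<in> S"
    have Re: "Re y \<ge> Re x / 2" if "y \<in> cball x (Re x / 2)" for y
      using that abs_Re_le_cmod[of "x - y"] by (simp add: dist_norm)
    show "\<exists>e>0. cball x e \<subseteq> S \<and> uniform_limit (cball x e) (\<lambda>n x. \<Sum>k<n. d k x) (\<lambda>x. \<Sum>k. d k x) sequentially"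
    proof (intro exI[of _ "Re x / 2"] conjI Weierstrass_m_test)
      show "Re x / 2 > 0" using x by (simp add: S_def)
      show "cball x (Re x / 2) \<subseteq> S" using Re x by (force simp: S_def)
      show "norm (d k y) \<le> 1 / (real (Suc k) * (Re x / 2)) ^ 2" if "y \<in> cball x (Re x / 2)" for k y
        using Re[OF that] x by (intro bound) (auto simp: S_def)
    qed (rule summable_inverse_Suc_squared)
  qed
  then have "(\<lambda>x. (\<Sum>k. d k x) + of_real (ln 2) / (2 * x) + of_real (ln 2)) holomorphic_on S"
    by (intro holomorphic_intros) (auto simp: S_def)
  then have "calJ1 holomorphic_on S"
    by (rule holomorphic_transform) (use J1_sums in \<open>simp add: S_def d_def calJ1_def sums_iff\<close>)
  then show ?thesis by (simp add: S_def)
qed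

text \<open>
  For nonreal $x$ the substitution $t = xu$ would rotate the path of integration; the identity
  theorem, applied from the positive real axis, replaces this.
\<close>
lemma calJ1_reciprocal:
  assumes "Re x > 0"
  shows "calJ1 x - 1 / x * calJ1 (1 / x) = 0"
proof (rule analytic_continuation[where f = "\<lambda>x. calJ1 x - 1 / x * calJ1 (1 / x)" and w = x and S = "{x. Re x > 0}" and U = "of_real ` {0<..}" and \<xi> = 1])
  show "(\<lambda>x. calJ1 x - 1 / x * calJ1 (1 / x)) holomorphic_on {x. Re x > 0}"
    by (intro holomorphic_intros calJ1_holomorphic
        holomorphic_on_compose_gen[of "\<lambda>x. 1 / x" _ calJ1 "{x. Re x > 0}", unfolded o_def])
      (use Re_inverse_pos in auto)
  show "open {x. Re x > 0}" by (rule open_halfspace_Re_gt)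
  show "connected {x. Re x > 0}" by (intro convex_connected convex_halfspace_Re_gt)
  show "(1 :: complex) islimpt of_real ` {0<..}"
  proof -
    have "(1 :: real) islimpt {0<..}"
      by (intro interior_limit_point) (simp add: interior_open)
    then have "of_real 1 islimpt (of_real ` {0<..} :: complex set)"
      by (rule islimpt_isCont_image) (auto simp: eventually_at_filter)
    then show ?thesis by simp
  qed
  show "calJ1 z - 1 / z * calJ1 (1 / z) = 0" if "z \<in> of_real ` {0<..}" for z
    using that calJ1_reciprocal_real by auto
qed (use assms in auto)

theorem theorem4p5:
  fixes x :: complex
  assumes "Re x > 0"
  shows "calJ1 x = 3 * calF1 x - 2 * calF1 (2 * x) - calF1 (x / 2)
                   + (1 + x) / (2 * x) * of_real (ln 2)
         \<and> calJ1 x - 1 / x * calJ1 (1 / x) = 0"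
  using calJ1_eq_calF1[OF assms] calJ1_reciprocal[OF assms] by blast

end
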